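(* Let $G$ be a connected graph. Then $G$ has a tree set $T$ of separations of $G$ such that the set of separators $\{A\cap B:\{A,B\}\in T\}$ is precisely the set of critical vertex sets of $G$, and such that for every consistent orientation $O$ of $T$ the torso of $O$ is tough.
   Context: A separation of $G=(V,E)$ is an unordered pair $\{A,B\}$ with $A\cup B=V$ and no edge of $G$ between $A\setminus B$ and $B\setminus A$; its separator is $A\cap B$; its orientations are $(A,B)$ and $(B,A)$ (each the inverse of the other), ordered by $(A,B)\le(C,D)$ iff $A\subseteq C$ and $B\supseteq D$. A set $T$ of separations is nested if every two of them have comparable orientations; an orientation $\vec r$ is degenerate if $\vec r=\overleftarrow r$ and trivial if there is $s\in T$, $s\neq r$, with $\vec r<\vec s$ and $\vec r<\overleftarrow s$; a tree set is a nested set of separations with no degenerate or trivial orientations. An orientation of $T$ is a set $O$ containing exactly one orientation of each separation of $T$; it is consistent if there are no distinct $r,s\in T$ with orientations $\vec r<\vec s$ such that $\overleftarrow r\in O$ and $\vec s\in O$. The part of $O$ is $\Pi=\bigcap\{B:(A,B)\in O\}$, and the torso of $O$ is the graph obtained from $G[\Pi]$ by adding an edge $xy$ for all distinct $x,y\in\Pi$ that lie together in the separator of some separation of $O$. For $X\subseteq V$, $\check{\mathcal C}_X$ denotes the set of components $C$ of $G-X$ whose neighbourhood $N(C)$ equals $X$. A finite $X\subseteq V$ is critical if $\check{\mathcal C}_X$ is infinite. A graph is tough if deleting finitely many vertices from it never leaves infinitely many components. *)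

theory Defs
  imports Main
begin

section \<open>Graphs\<close>

text \<open>
  Undirected simple graphs of arbitrary cardinality; an edge is a two-element set of vertices.
\<close>

record 'a graph =
  verts :: "'a set"
  edges :: "'a set set"

definition simple_graph :: "'a graph \<Rightarrow> bool" where
  "simple_graph G \<longleftrightarrow> (\<forall>e\<in>edges G. e \<subseteq> verts G \<and> card e = 2)"

definition adj :: "'a graph \<Rightarrow> 'a \<Rightarrow> 'a \<Rightarrow> bool" where
  "adj G x y \<longleftrightarrow> {x, y} \<in> edges G"

definition induced_subgraph :: "'a graph \<Rightarrow> 'a set \<Rightarrow> 'a graph" where
  "induced_subgraph G U = \<lparr>verts = verts G \<inter> U, edges = {e \<in> edges G. e \<subseteq> U}\<rparr>"

definition delete_verts :: "'a graph \<Rightarrow> 'a set \<Rightarrow> 'a graph" where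
  "delete_verts G X = induced_subgraph G (verts G - X)"

text \<open>
  Two vertices are linked if there is a walk between them. Components are given by their vertex
  sets. A connected graph is required to be non-empty.
\<close>

definition linked :: "'a graph \<Rightarrow> 'a \<Rightarrow> 'a \<Rightarrow> bool" where
  "linked G x y \<longleftrightarrow> x \<in> verts G \<and> y \<in> verts G \<and> (adj G)\<^sup>*\<^sup>* x y"

definition connected_graph :: "'a graph \<Rightarrow> bool" where
  "connected_graph G \<longleftrightarrow> verts G \<noteq> {} \<and> (\<forall>x\<in>verts G. \<forall>y\<in>verts G. linked G x y)"

definition graph_components :: "'a graph \<Rightarrow> 'a set set" where
  "graph_components G = {{y. linked G x y} | x. x \<in> verts G}"

definition neighbourhood :: "'a graph \<Rightarrow> 'a set \<Rightarrow> 'a set" where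
  "neighbourhood G C = {v \<in> verts G - C. \<exists>u\<in>C. adj G u v}"

definition full_components :: "'a graph \<Rightarrow> 'a set \<Rightarrow> 'a set set" where
  "full_components G X = {C \<in> graph_components (delete_verts G X). neighbourhood G C = X}"

definition critical :: "'a graph \<Rightarrow> 'a set \<Rightarrow> bool" where
  "critical G X \<longleftrightarrow> X \<subseteq> verts G \<and> finite X \<and> infinite (full_components G X)"

definition tough :: "'a graph \<Rightarrow> bool" where
  "tough G \<longleftrightarrow>
     (\<forall>X. X \<subseteq> verts G \<and> finite X \<longrightarrow> finite (graph_components (delete_verts G X)))"


section \<open>Separations and tree sets\<close>

text \<open>
  An unoriented separation is the set \<open>{A, B}\<close> of its two sides (a singleton if it is degenerate);
  its orientations are ordered pairs, and \<open>prod.swap\<close> inverts an orientation.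
\<close>

type_synonym 'a sep = "'a set set"
type_synonym 'a orsep = "'a set \<times> 'a set"

definition is_separation :: "'a graph \<Rightarrow> 'a sep \<Rightarrow> bool" where
  "is_separation G s \<longleftrightarrow>
     (\<exists>A B. s = {A, B} \<and> A \<union> B = verts G \<and> \<not> (\<exists>x\<in>A - B. \<exists>y\<in>B - A. adj G x y))"

definition orientations :: "'a sep \<Rightarrow> 'a orsep set" where
  "orientations s = {(A, B). {A, B} = s}"

definition sep_le :: "'a orsep \<Rightarrow> 'a orsep \<Rightarrow> bool" where
  "sep_le p q \<longleftrightarrow> fst p \<subseteq> fst q \<and> snd q \<subseteq> snd p"

definition sep_less :: "'a orsep \<Rightarrow> 'a orsep \<Rightarrow> bool" where
  "sep_less p q \<longleftrightarrow> sep_le p q \<and> p \<noteq> q"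

definition nested :: "'a sep set \<Rightarrow> bool" where
  "nested T \<longleftrightarrow>
     (\<forall>r\<in>T. \<forall>s\<in>T. \<exists>p\<in>orientations r. \<exists>q\<in>orientations s. sep_le p q \<or> sep_le q p)"

definition degenerate :: "'a orsep \<Rightarrow> bool" where
  "degenerate p \<longleftrightarrow> p = prod.swap p"

definition trivial_in :: "'a sep set \<Rightarrow> 'a orsep \<Rightarrow> bool" where
  "trivial_in T p \<longleftrightarrow>
     (\<exists>s\<in>T. p \<notin> orientations s \<and>
        (\<exists>q\<in>orientations s. sep_less p q \<and> sep_less p (prod.swap q)))"

definition tree_set :: "'a graph \<Rightarrow> 'a sep set \<Rightarrow> bool" where
  "tree_set G T \<longleftrightarrow>
     (\<forall>s\<in>T. is_separation G s) \<and> nested T \<and>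
     (\<forall>r\<in>T. \<forall>p\<in>orientations r. \<not> degenerate p \<and> \<not> trivial_in T p)"

definition orientation_of :: "'a sep set \<Rightarrow> 'a orsep set \<Rightarrow> bool" where
  "orientation_of T Or \<longleftrightarrow>
     Or \<subseteq> (\<Union>s\<in>T. orientations s) \<and> (\<forall>s\<in>T. \<exists>!p. p \<in> orientations s \<and> p \<in> Or)"

definition consistent :: "'a sep set \<Rightarrow> 'a orsep set \<Rightarrow> bool" where
  "consistent T Or \<longleftrightarrow>
     \<not> (\<exists>r\<in>T. \<exists>s\<in>T. r \<noteq> s \<and>
          (\<exists>p\<in>orientations r. \<exists>q\<in>orientations s.
             sep_less p q \<and> prod.swap p \<in> Or \<and> q \<in> Or))"

text \<open>The empty intersection is read as the whole vertex set.\<close>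

definition part :: "'a graph \<Rightarrow> 'a orsep set \<Rightarrow> 'a set" where
  "part G Or = {v \<in> verts G. \<forall>(A, B)\<in>Or. v \<in> B}"

definition torso :: "'a graph \<Rightarrow> 'a orsep set \<Rightarrow> 'a graph" where
  "torso G Or =
     \<lparr>verts = part G Or,
      edges = edges (induced_subgraph G (part G Or)) \<union>
        {{x, y} | x y. x \<in> part G Or \<and> y \<in> part G Or \<and> x \<noteq> y \<and>
           (\<exists>(A, B)\<in>Or. x \<in> A \<inter> B \<and> y \<in> A \<inter> B)}\<rparr>"

end

theory Submission
  imports Defs
begin

text \<open>
  For critical \<open>X\<close> and \<open>Y \<not>\<subseteq> X\<close>, the set \<open>Y - X\<close> lies in a single component \<open>C\<^sub>X(Y)\<close> of \<open>G - X\<close>,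
  as any two of its vertices are joined through infinitely many full components of \<open>Y\<close>. The
  separations cutting a single full component off its neighbourhood are almost nested: crossings
  occur only between \<open>C\<^sub>X(Y)\<close> and \<open>C\<^sub>Y(X)\<close> for incomparable \<open>X, Y\<close> for which both components are
  full, and the only obstruction is formed by common non-full components. Call such \<open>X\<close> and \<open>Y\<close>
  entangled. If \<open>X\<close> is entangled with \<open>Y\<close> and \<open>W\<close> and \<open>C\<^sub>X(Y) \<noteq> C\<^sub>X(W)\<close>, then \<open>Y\<close> and \<open>W\<close> are
  entangled, too. So let \<open>S\<close> be a maximal set of pairwise non-entangled critical sets; every \<open>X\<close>
  outside \<open>S\<close> sees all its entangled partners in \<open>S\<close> in the same full component (its pole), and
  moving all non-full components of \<open>G - X\<close> to this component makes everything nested.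

  Paths in \<open>G - X\<close> between vertices of a part can be shortcut to paths in the torso. So if the torso
  is not tough, then infinitely many components of some \<open>G - X\<close> meet the part, and hence infinitely many
  full components of some critical subset of \<open>X\<close> do, which the star of separations at this
  subset prevents.
\<close>

section \<open>Components\<close>

abbreviation comps :: "'a graph \<Rightarrow> 'a set \<Rightarrow> 'a set set" where
  "comps G X \<equiv> graph_components (delete_verts G X)"

lemma adj_sym: "adj G u v \<Longrightarrow> adj G v u"
  by (simp add: adj_def insert_commute)

lemma linked_refl: "x \<in> verts G \<Longrightarrow> linked G x x"
  by (simp add: linked_def)

lemma linked_sym: "linked G x y \<Longrightarrow> linked G y x"
  unfolding linked_def
  by (metis adj_sym sympD sympI symp_rtranclp)

lemma linked_trans: "linked G x y \<Longrightarrow> linked G y z \<Longrightarrow> linked G x z"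
  by (auto simp: linked_def)

lemma verts_delete_verts [simp]: "verts (delete_verts G X) = verts G - X"
  by (auto simp: delete_verts_def induced_subgraph_def)

lemma component_eq:
  assumes "C \<in> graph_components G" "c \<in> C"
  shows "C = {y. linked G c y}"
  using assms linked_sym linked_trans unfolding graph_components_def by fast

lemma component_disjoint:
  assumes "C \<in> graph_components G" "D \<in> graph_components G" "c \<in> C" "c \<in> D"
  shows "C = D"
  using component_eq[OF assms(1,3)] component_eq[OF assms(2,4)] by simp

lemma component_nonempty: "C \<in> graph_components G \<Longrightarrow> C \<noteq> {}"
  by (auto simp: graph_components_def intro: linked_refl)

lemma component_cover: "v \<in> verts G \<Longrightarrow> \<exists>C \<in> graph_components G. v \<in> C"
  by (auto simp: graph_components_def intro: linked_refl)

lemma comps_subset: "C \<in> comps G X \<Longrightarrow> C \<subseteq> verts G - X"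
  by (auto simp: graph_components_def linked_def)

lemma comps_cover: "v \<in> verts G \<Longrightarrow> v \<notin> X \<Longrightarrow> \<exists>C \<in> comps G X. v \<in> C"
  using component_cover[of v "delete_verts G X"] by simp

lemma full_components_comps: "C \<in> full_components G X \<Longrightarrow> C \<in> comps G X"
  by (simp add: full_components_def)

lemma full_components_adj:
  "C \<in> full_components G X \<Longrightarrow> x \<in> X \<Longrightarrow> \<exists>c\<in>C. adj G c x"
  by (auto simp: full_components_def neighbourhood_def)

text \<open>Zorn's lemma for sets of pairwise unrelated elements: a maximal one cannot be extended
  by \<open>x\<close>, so \<open>x\<close> is related to one of its members. With entanglement as
  \<open>r\<close> this yields the set \<open>S\<close>.\<close>

lemma ex_maximal_independent:
  assumes sym: "\<And>x y. r x y \<Longrightarrow> r y x" and irrefl: "\<And>x. \<not> r x x"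
  shows "\<exists>S. (\<forall>x\<in>S. \<forall>y\<in>S. \<not> r x y) \<and> (\<forall>x. x \<notin> S \<longrightarrow> (\<exists>y\<in>S. r x y))"
proof -
  define P where "P = {S. \<forall>x\<in>S. \<forall>y\<in>S. \<not> r x y}"
  have "\<exists>M\<in>P. \<forall>S\<in>P. M \<subseteq> S \<longrightarrow> S = M"
  proof (rule subset_Zorn_nonempty)
    fix \<C> assume \<C>: "\<C> \<noteq> {}" "subset.chain P \<C>"
    have *: "\<not> r x y" if "x \<in> A" "A \<in> \<C>" "y \<in> B" "B \<in> \<C>" for x y A B
    proof -
      have "A \<in> P" "B \<in> P" "A \<subseteq> B \<or> B \<subseteq> A"
        using \<C>(2) that(2,4) unfolding subset_chain_def by blast+
      then show ?thesis using that(1,3) unfolding P_def by blast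
    qed
    show "\<Union>\<C> \<in> P" unfolding P_def by (intro CollectI ballI, elim UnionE, rule *)
  next
    have "{} \<in> P" by (simp add: P_def)
    then show "P \<noteq> {}" by blast
  qed
  then obtain M where M: "M \<in> P" "\<forall>S\<in>P. M \<subseteq> S \<longrightarrow> S = M" by blast
  have "\<exists>y\<in>M. r x y" if x: "x \<notin> M" for x
  proof (rule ccontr)
    assume "\<not> ?thesis"
    then have "insert x M \<in> P" using M(1) irrefl[of x] sym[of _ x] unfolding P_def by blast
    then have "insert x M = M" using M(2) by blast
    then show False using x by blast
  qed
  then show ?thesis using M(1) unfolding P_def by blast
qed

context
  fixes G :: "'a graph"
  assumes simple: "simple_graph G"
begin

lemma adj_verts: "adj G u v \<Longrightarrow> u \<in> verts G \<and> v \<in> verts G"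
  using simple by (auto simp: simple_graph_def adj_def)

lemma adj_delete_verts: "adj (delete_verts G X) u v \<longleftrightarrow> adj G u v \<and> u \<notin> X \<and> v \<notin> X"
  using adj_verts[of u v] by (auto simp: adj_def delete_verts_def induced_subgraph_def)

lemma comps_closed:
  assumes "C \<in> comps G X" "u \<in> C" "adj G u v" "v \<notin> X"
  shows "v \<in> C"
proof -
  have "u \<notin> X" using assms comps_subset by fast
  then have "linked (delete_verts G X) u v"
    using assms adj_verts[OF assms(3)] by (auto simp: linked_def adj_delete_verts)
  then show ?thesis using component_eq[OF assms(1,2)] by simp
qed

text \<open>A walk from \<open>c\<close> inside \<open>C\<close> avoids \<open>Y\<close>, so it
  never leaves \<open>D\<close>.\<close>

lemma comps_absorb:
  assumes C: "C \<in> comps G X" and disj: "C \<inter> Y = {}" and D: "D \<in> comps G Y"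
    and c: "c \<in> C" "c \<in> D"
  shows "C \<subseteq> D"
proof
  fix y assume "y \<in> C"
  then have "(adj (delete_verts G X))\<^sup>*\<^sup>* c y"
    using component_eq[OF C c(1)] by (simp add: linked_def)
  then have "y \<in> C \<and> y \<in> D"
  proof induction
    case base
    then show ?case using c by simp
  next
    case (step u v)
    then have uv: "adj G u v" "v \<notin> X" by (auto simp: adj_delete_verts)
    then have "v \<in> C" using comps_closed[OF C] step by blast
    then show ?case using comps_closed[OF D _ uv(1)] step disj by blast
  qed
  then show "y \<in> D" ..
qed

lemma neighbourhood_comps: "C \<in> comps G X \<Longrightarrow> neighbourhood G C \<subseteq> X"
  using comps_closed unfolding neighbourhood_def by blast

text \<open>Every edge leaving \<open>C\<close> ends in \<open>Y\<close>, so the component of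
  \<open>G - Y\<close> around a vertex of \<open>C\<close> cannot grow beyond \<open>C\<close>. This
  allows replacing a deleted set by the neighbourhood of a component.\<close>

lemma comps_change:
  assumes C: "C \<in> comps G X" and disj: "C \<inter> Y = {}" and N: "neighbourhood G C \<subseteq> Y"
  shows "C \<in> comps G Y"
proof -
  obtain c where c: "c \<in> C" using component_nonempty[OF C] by blast
  then have "c \<in> verts G" "c \<notin> Y" using comps_subset[OF C] disj by auto
  then obtain D where D: "D \<in> comps G Y" "c \<in> D" using comps_cover by meson
  have "y \<in> C" if "y \<in> D" for y
  proof -
    have "(adj (delete_verts G Y))\<^sup>*\<^sup>* c y"
      using component_eq[OF D] that by (simp add: linked_def)
    then show ?thesis
    proof induction
      case (step u v)
      then have "adj G u v" "v \<notin> Y" by (auto simp: adj_delete_verts)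
      then show ?case using step N adj_verts[of u v] unfolding neighbourhood_def by blast
    qed (use c in simp)
  qed
  then have "C = D" using comps_absorb[OF C disj D(1) c D(2)] by blast
  then show ?thesis using D by simp
qed

section \<open>Critical vertex sets\<close>

text \<open>The full components of \<open>Y\<close> are disjoint and infinitely many, so the finite
  set \<open>X\<close> cannot meet all of them.\<close>

lemma full_component_avoiding:
  assumes "critical G Y" "finite X"
  shows "\<exists>D \<in> full_components G Y. D \<inter> X = {}"
proof (rule ccontr)
  assume "\<not> ?thesis"
  then have "\<forall>D. \<exists>x. D \<in> full_components G Y \<longrightarrow> x \<in> D \<inter> X" by blast
  then obtain g where g: "D \<in> full_components G Y \<Longrightarrow> g D \<in> D \<inter> X" for D by metis
  have "inj_on g (full_components G Y)"
  proof (rule inj_onI)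
    fix D E assume DE: "D \<in> full_components G Y" "E \<in> full_components G Y" "g D = g E"
    then show "D = E"
      using component_disjoint[OF full_components_comps full_components_comps] g[of D] g[of E]
      by fastforce
  qed
  moreover have "g ` full_components G Y \<subseteq> X" using g by blast
  ultimately have "finite (full_components G Y)"
    using assms(2) finite_subset inj_on_finite by blast
  then show False using assms(1) by (simp add: critical_def)
qed

text \<open>Fullness gives an edge from \<open>C\<close> to \<open>x\<close>; as \<open>C\<close>
  avoids \<open>Y\<close>, this edge drags all of \<open>C\<close> into the component of
  \<open>x\<close>.\<close>

lemma full_component_absorb:
  assumes C: "C \<in> full_components G X" "C \<inter> Y = {}" and D: "D \<in> comps G Y"
    and x: "x \<in> X" "x \<in> D"
  shows "C \<subseteq> D"
proof -
  obtain c where c: "c \<in> C" "adj G c x" using full_components_adj[OF C(1) x(1)] by blast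
  then have "c \<notin> Y" using C by blast
  then have "c \<in> D" using comps_closed[OF D x(2) adj_sym[OF c(2)]] by simp
  then show ?thesis using comps_absorb[OF full_components_comps[OF C(1)] C(2) D c(1)] by simp
qed

lemma full_component_absorb_boundary:
  assumes C: "C \<in> full_components G X" "C \<subseteq> D" and D: "D \<in> comps G Y"
  shows "X - Y \<subseteq> D"
proof
  fix x assume x: "x \<in> X - Y"
  then obtain c where "c \<in> C" "adj G c x" using full_components_adj[OF C(1)] by blast
  then show "x \<in> D" using comps_closed[OF D] C x by blast
qed

section \<open>The direction in which one critical set sees another\<close>

text \<open>For finite \<open>X\<close> and critical \<open>Y\<close> not contained in
  \<open>X\<close> this is the component \<open>C\<^sub>X(Y)\<close>; taking a union makes the
  operation total.\<close>

definition towards :: "'a set \<Rightarrow> 'a set \<Rightarrow> 'a set" where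
  "towards X Y = \<Union>{C \<in> comps G X. C \<inter> Y \<noteq> {}}"

text \<open>A full component \<open>D\<close> of \<open>Y\<close> avoiding \<open>X\<close> is
  attached to every vertex of \<open>Y\<close>. So each component of \<open>G - X\<close> that meets
  \<open>Y\<close> contains \<open>D\<close>, and there can be only one.\<close>

lemma towards_eq:
  assumes Y: "critical G Y" and X: "finite X" and C: "C \<in> comps G X" "C \<inter> Y \<noteq> {}"
  shows "towards X Y = C" "Y - X \<subseteq> C"
proof -
  obtain D where D: "D \<in> full_components G Y" "D \<inter> X = {}"
    using full_component_avoiding[OF Y X] by blast
  have meet: "D \<subseteq> C'" if C': "C' \<in> comps G X" "C' \<inter> Y \<noteq> {}" for C'
    using full_component_absorb[OF D C'(1)] C'(2) by blast
  show "Y - X \<subseteq> C" using full_component_absorb_boundary[OF D(1) meet[OF C] C(1)] .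
  then show "towards X Y = C"
    using C component_disjoint comps_subset unfolding towards_def by fast
qed

lemma towards_comps:
  assumes "critical G Y" "finite X" "\<not> Y \<subseteq> X"
  shows "towards X Y \<in> comps G X" "Y - X \<subseteq> towards X Y"
proof -
  obtain y where y: "y \<in> Y" "y \<notin> X" using assms by blast
  then have "y \<in> verts G" using assms by (auto simp: critical_def)
  then obtain C where "C \<in> comps G X" "y \<in> C" using y comps_cover by meson
  then show "towards X Y \<in> comps G X" "Y - X \<subseteq> towards X Y"
    using towards_eq[OF assms(1,2)] y by (metis IntI empty_iff)+
qed

lemma critical_finite: "critical G X \<Longrightarrow> finite X"
  by (simp add: critical_def)

definition entangled :: "'a set \<Rightarrow> 'a set \<Rightarrow> bool" where
  "entangled X Y \<longleftrightarrow> critical G X \<and> critical G Y \<and> \<not> X \<subseteq> Y \<and> \<not> Y \<subseteq> X \<and>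
     towards X Y \<in> full_components G X \<and> towards Y X \<in> full_components G Y"

lemma entangled_sym: "entangled X Y \<Longrightarrow> entangled Y X"
  by (simp add: entangled_def)

text \<open>The component of \<open>G - X\<close> towards \<open>Y\<close> misses \<open>W\<close>,
  since \<open>W - X\<close> lies in a different one. Being full, it is attached to
  \<open>X - W\<close>, so in \<open>G - W\<close> it joins \<open>Y\<close> to
  \<open>X\<close>.\<close>

lemma entangled_branch_towards:
  assumes XY: "entangled X Y" and XW: "entangled X W" and ne: "towards X Y \<noteq> towards X W"
  shows "towards W Y = towards W X" "\<not> Y \<subseteq> W"
proof -
  have crit: "critical G X" "critical G Y" "critical G W"
    and sub: "\<not> X \<subseteq> W" "\<not> Y \<subseteq> X" "\<not> W \<subseteq> X"
    and fullY: "towards X Y \<in> full_components G X"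
    using XY XW by (auto simp: entangled_def)
  note fin = crit[THEN critical_finite]
  note XtY = towards_comps[OF crit(2) fin(1) sub(2)]
  note XtW = towards_comps[OF crit(3) fin(1) sub(3)]
  note WtX = towards_comps[OF crit(1) fin(3) sub(1)]
  have disj: "towards X Y \<inter> W = {}"
    using component_disjoint[OF XtY(1) XtW(1)] ne XtW(2) comps_subset[OF XtY(1)] by blast
  show "\<not> Y \<subseteq> W" using disj XtY(2) sub(2) by blast
  then obtain x where "x \<in> X" "x \<in> towards W X" using WtX(2) sub(1) by blast
  then have "towards X Y \<subseteq> towards W X"
    using full_component_absorb[OF fullY disj WtX(1)] by blast
  then have "towards W X \<inter> Y \<noteq> {}" using XtY(2) sub(2) by blast
  then show "towards W Y = towards W X"
    using towards_eq(1)[OF crit(2) fin(3) WtX(1)] by blast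
qed

text \<open>By the previous lemma and its mirror image, \<open>Y\<close> and \<open>W\<close> see
  each other where they see \<open>X\<close>, and those components are full by entanglement with
  \<open>X\<close>.\<close>

lemma entangled_branch:
  assumes "entangled X Y" "entangled X W" "towards X Y \<noteq> towards X W"
  shows "entangled Y W"
proof -
  note Y = entangled_branch_towards[OF assms]
  note W = entangled_branch_towards[OF assms(2,1) assms(3)[symmetric]]
  show ?thesis using assms(1,2) Y(2) W(2) unfolding entangled_def Y(1) W(1) by blast
qed

section \<open>The tree set\<close>

definition cut :: "'a set \<Rightarrow> 'a set \<Rightarrow> 'a sep" where
  "cut X Q = {X \<union> Q, verts G - Q}"

text \<open>A cut can be described by either of its strict sides; the nestedness proofs pick
  whichever is convenient.\<close>

lemma cut_compl:
  assumes "X \<subseteq> verts G" "Q \<subseteq> verts G - X"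
  shows "cut X (verts G - X - Q) = cut X Q"
proof -
  have "X \<union> (verts G - X - Q) = verts G - Q" "verts G - (verts G - X - Q) = X \<union> Q"
    using assms by auto
  then show ?thesis by (auto simp: cut_def)
qed

text \<open>The criterion to which all nestedness proofs reduce: suitable strict sides are disjoint
  and avoid the other separator.\<close>

lemma cut_nested:
  assumes "X \<subseteq> verts G" "Y \<subseteq> verts G" "Q \<subseteq> verts G - X" "R \<subseteq> verts G - Y"
    and "Q \<inter> Y = {}" "R \<inter> X = {}" "Q \<inter> R = {}"
  shows "\<exists>p\<in>orientations (cut X Q). \<exists>q\<in>orientations (cut Y R). sep_le p q \<or> sep_le q p"
proof (intro bexI disjI1)
  show "(X \<union> Q, verts G - Q) \<in> orientations (cut X Q)"
    "(verts G - R, Y \<union> R) \<in> orientations (cut Y R)"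
    by (auto simp: orientations_def cut_def)
  show "sep_le (X \<union> Q, verts G - Q) (verts G - R, Y \<union> R)"
    using assms by (auto simp: sep_le_def)
qed

definition nonfull :: "'a set \<Rightarrow> 'a set" where
  "nonfull X = \<Union>(comps G X - full_components G X)"

text \<open>A predicate rather than a function, because a set without entangled partner in
  \<open>S\<close> has no pole.\<close>

definition pole :: "'a set set \<Rightarrow> 'a set \<Rightarrow> 'a set \<Rightarrow> bool" where
  "pole S X C \<longleftrightarrow> (\<exists>Y\<in>S. entangled X Y \<and> towards X Y = C)"

text \<open>If \<open>X\<close> has a unique pole, every cut at \<open>X\<close> has the non-full
  components on the side of the pole. Without a pole they lie opposite the component that is cut
  off.\<close>

definition lobe :: "'a set set \<Rightarrow> 'a set \<Rightarrow> 'a set \<Rightarrow> 'a set" where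
  "lobe S X C = (if pole S X C then C \<union> nonfull X else C)"

definition lobe_cuts :: "'a set set \<Rightarrow> 'a sep set" where
  "lobe_cuts S = {cut X (lobe S X C) | X C. critical G X \<and> C \<in> full_components G X}"

lemma nonfull_disjoint: "C \<in> full_components G X \<Longrightarrow> C \<inter> nonfull X = {}"
  using component_disjoint full_components_comps unfolding nonfull_def by fast

lemma nonfull_component:
  "K \<in> comps G X \<Longrightarrow> K \<notin> full_components G X \<Longrightarrow> K \<subseteq> nonfull X"
  unfolding nonfull_def by blast

lemma comps_full_or_nonfull:
  "v \<in> verts G \<Longrightarrow> v \<notin> X \<Longrightarrow> (\<exists>C\<in>full_components G X. v \<in> C) \<or> v \<in> nonfull X"
  using comps_cover[of v G X] by (auto simp: nonfull_def)

lemma nonfull_subset: "nonfull X \<subseteq> verts G - X"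
  unfolding nonfull_def using comps_subset by blast

lemma lobe_subset: "C \<in> full_components G X \<Longrightarrow> lobe S X C \<subseteq> verts G - X"
  using comps_subset[OF full_components_comps] nonfull_subset by (auto simp: lobe_def split: if_splits)

text \<open>Both \<open>C\<close> and \<open>nonfull X\<close> are unions of components of
  \<open>G - X\<close>, hence so is the lobe.\<close>

lemma lobe_comp:
  assumes "C \<in> full_components G X" "K \<in> comps G X" "v \<in> K" "v \<in> lobe S X C"
  shows "K \<subseteq> lobe S X C"
proof -
  consider "v \<in> C" | K' where "pole S X C" "K' \<in> comps G X - full_components G X" "v \<in> K'"
    using assms(4) by (auto simp: lobe_def nonfull_def split: if_splits)
  then show ?thesis
  proof cases
    case 1
    then have "K = C"
      using component_disjoint[OF assms(2) full_components_comps[OF assms(1)] assms(3)] by blast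
    then show ?thesis by (simp add: lobe_def)
  next
    case 2
    then have "K = K'" using component_disjoint[OF assms(2) _ assms(3)] by blast
    then have "K \<subseteq> nonfull X" using 2(2) nonfull_component by blast
    then show ?thesis using 2(1) by (auto simp: lobe_def)
  qed
qed

lemma lobe_full_disjoint:
  assumes "C \<in> full_components G X" "C' \<in> full_components G X" "C \<noteq> C'"
  shows "lobe S X C \<inter> C' = {}"
proof -
  have "C \<inter> C' = {}"
    using component_disjoint[OF assms(1,2)[THEN full_components_comps]] assms(3) by blast
  then show ?thesis using nonfull_disjoint[OF assms(2)] by (auto simp: lobe_def)
qed

lemma lobe_cut_separation:
  assumes X: "critical G X" and C: "C \<in> full_components G X"
  shows "is_separation G (cut X (lobe S X C))"
proof -
  let ?Q = "lobe S X C"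
  have sub: "X \<subseteq> verts G" "?Q \<subseteq> verts G - X"
    using X lobe_subset[OF C] by (auto simp: critical_def)
  have "\<not> adj G x y" if "x \<in> ?Q" "y \<in> verts G - X - ?Q" for x y
  proof
    assume xy: "adj G x y"
    have "x \<in> verts G" "x \<notin> X" using that(1) sub(2) by auto
    then obtain K where K: "K \<in> comps G X" "x \<in> K" using comps_cover by meson
    have "y \<in> K" using comps_closed[OF K xy] that(2) by blast
    then show False using lobe_comp[OF C K that(1)] that(2) by blast
  qed
  moreover have "X \<union> ?Q \<union> (verts G - ?Q) = verts G" "X \<union> ?Q - (verts G - ?Q) = ?Q"
    "verts G - ?Q - (X \<union> ?Q) = verts G - X - ?Q"
    using sub by auto
  ultimately show ?thesis
    unfolding is_separation_def cut_def
    by (intro exI[of _ "X \<union> ?Q"] exI[of _ "verts G - ?Q"]) simp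
qed

text \<open>Take the complement of the lobe if \<open>C\<close> is a pole, and the lobe itself
  otherwise.\<close>

lemma lobe_cut_full_side:
  assumes X: "critical G X" and C: "C \<in> full_components G X"
  shows "\<exists>Q \<subseteq> verts G - X. cut X (lobe S X C) = cut X Q \<and> Q \<inter> nonfull X = {}"
proof (cases "pole S X C")
  case True
  then have "(verts G - X - lobe S X C) \<inter> nonfull X = {}" by (auto simp: lobe_def)
  then show ?thesis
    using cut_compl[OF _ lobe_subset[OF C]] X by (metis Diff_subset critical_def)
next
  case False
  then show ?thesis using lobe_subset[OF C, of S] nonfull_disjoint[OF C] by (auto simp: lobe_def)
qed

section \<open>Poles with respect to a maximal set of pairwise non-entangled sets\<close>

text \<open>The quantifiers range over all sets: those that are not critical are entangled with
  nothing and therefore belong to \<open>S\<close>.\<close>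

definition disentangled :: "'a set set \<Rightarrow> bool" where
  "disentangled S \<longleftrightarrow> (\<forall>X\<in>S. \<forall>Y\<in>S. \<not> entangled X Y) \<and>
     (\<forall>X. X \<notin> S \<longrightarrow> (\<exists>Y\<in>S. entangled X Y))"

lemma ex_disentangled: "\<exists>S. disentangled S"
  unfolding disentangled_def
  by (rule ex_maximal_independent) (auto simp: entangled_def)

text \<open>Two partners in \<open>S\<close> seen in different directions would be entangled with
  each other by \<open>entangled_branch\<close>.\<close>

lemma pole_unique: "disentangled S \<Longrightarrow> pole S X C \<Longrightarrow> pole S X C' \<Longrightarrow> C = C'"
  using entangled_branch unfolding pole_def disentangled_def by metis

text \<open>If neither set is in \<open>S\<close>, take a partner \<open>W\<close> of
  \<open>X\<close> in \<open>S\<close>. Either \<open>X\<close> sees \<open>W\<close> where it sees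
  \<open>Y\<close>, or \<open>W\<close> is also a partner of \<open>Y\<close>, seen from
  \<open>Y\<close> in the direction of \<open>X\<close>.\<close>

lemma pole_entangled:
  assumes S: "disentangled S" and XY: "entangled X Y"
  shows "pole S X (towards X Y) \<or> pole S Y (towards Y X)"
proof (cases "X \<in> S \<or> Y \<in> S")
  case True
  then show ?thesis using XY entangled_sym[OF XY] by (auto simp: pole_def)
next
  case False
  then obtain W where W: "W \<in> S" "entangled X W" using S unfolding disentangled_def by blast
  show ?thesis
  proof (cases "towards X Y = towards X W")
    case True
    then show ?thesis using W by (auto simp: pole_def)
  next
    case False
    then have "entangled Y W" "towards Y W = towards Y X"
      using entangled_branch[OF XY W(2)] entangled_branch_towards(1)[OF W(2) XY] by auto
    then show ?thesis using W(1) by (auto simp: pole_def)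
  qed
qed

text \<open>The side away from \<open>C0\<close> can contain non-full components only if
  \<open>C0\<close> is full and not the pole, since these components accompany the pole, if there is
  one, and otherwise lie opposite \<open>C\<close>.\<close>

lemma lobe_cut_side:
  assumes S: "disentangled S" and X: "critical G X" and C: "C \<in> full_components G X"
    and C0: "C0 \<in> comps G X"
  shows "\<exists>Q \<subseteq> verts G - X. cut X (lobe S X C) = cut X Q \<and> Q \<inter> C0 = {} \<and>
    (Q \<inter> nonfull X = {} \<or> C0 \<in> full_components G X \<and> \<not> pole S X C0)"
proof (cases "lobe S X C \<inter> C0 = {}")
  case True
  have "C0 \<in> full_components G X \<and> \<not> pole S X C0" if "pole S X C"
  proof
    show "C0 \<in> full_components G X"
      using True that nonfull_component[OF C0] component_nonempty[OF C0]
      by (auto simp: lobe_def)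
    have "C \<noteq> C0" using True component_nonempty[OF C0] by (auto simp: lobe_def split: if_splits)
    then show "\<not> pole S X C0" using pole_unique[OF S that] by blast
  qed
  moreover have "lobe S X C \<inter> nonfull X = {}" if "\<not> pole S X C"
    using that nonfull_disjoint[OF C] by (simp add: lobe_def)
  ultimately show ?thesis
    using True lobe_subset[OF C, of S] by blast
next
  case False
  then have sub: "C0 \<subseteq> lobe S X C" using lobe_comp[OF C C0] by blast
  let ?Q = "verts G - X - lobe S X C"
  have "C0 \<in> full_components G X \<and> \<not> pole S X C0" if "\<not> pole S X C"
  proof -
    have "C \<inter> C0 \<noteq> {}" using that False by (simp add: lobe_def)
    then have "C0 = C" using component_disjoint[OF C0 full_components_comps[OF C]] by blast
    then show ?thesis using that C by simp
  qed
  moreover have "?Q \<inter> nonfull X = {}" if "pole S X C" using that by (auto simp: lobe_def)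
  moreover have "cut X ?Q = cut X (lobe S X C)"
    using cut_compl lobe_subset[OF C] X by (simp add: critical_def)
  moreover have "?Q \<subseteq> verts G - X" "?Q \<inter> C0 = {}" using sub by auto
  ultimately show ?thesis by metis
qed

section \<open>Nestedness of the cuts\<close>

text \<open>Every full component of \<open>Y\<close> avoids \<open>X\<close> and is attached to
  \<open>Y - X\<close>, so it lies in \<open>towards X Y\<close>. A side \<open>R\<close> made of
  full components of \<open>Y\<close> is thus disjoint from a side \<open>Q\<close> avoiding
  \<open>towards X Y\<close>.\<close>

lemma lobe_cuts_nested_subset:
  assumes S: "disentangled S" and X: "critical G X" and C: "C \<in> full_components G X"
    and Y: "critical G Y" and D: "D \<in> full_components G Y" and XY: "X \<subset> Y"
  shows "\<exists>p\<in>orientations (cut X (lobe S X C)). \<exists>q\<in>orientations (cut Y (lobe S Y D)).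
    sep_le p q \<or> sep_le q p"
proof -
  have "\<not> Y \<subseteq> X" using XY by blast
  note C0 = towards_comps[OF Y critical_finite[OF X] this]
  obtain Q where Q: "Q \<subseteq> verts G - X" "cut X (lobe S X C) = cut X Q" "Q \<inter> towards X Y = {}"
    using lobe_cut_side[OF S X C C0(1)] by blast
  obtain R where R: "R \<subseteq> verts G - Y" "cut Y (lobe S Y D) = cut Y R" "R \<inter> nonfull Y = {}"
    using lobe_cut_full_side[OF Y D, of S] by blast
  have "v \<in> towards X Y" if v: "v \<in> R" for v
  proof -
    obtain E where E: "E \<in> full_components G Y" "v \<in> E"
      using comps_full_or_nonfull[of v Y] v R by blast
    have "E \<inter> X = {}" using comps_subset[OF full_components_comps[OF E(1)]] XY by blast
    moreover obtain y where "y \<in> Y" "y \<in> towards X Y" using C0(2) XY by blast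
    ultimately show ?thesis using full_component_absorb[OF E(1) _ C0(1)] E(2) by blast
  qed
  then have "Q \<inter> Y = {}" "R \<inter> X = {}" "Q \<inter> R = {}" using Q C0(2) XY R(1) by auto
  then show ?thesis
    using cut_nested[OF _ _ Q(1) R(1)] X Y Q(2) R(2) by (simp add: critical_def)
qed

text \<open>A full component of \<open>X\<close> other than \<open>towards X Y\<close> misses
  \<open>Y\<close> and is attached to \<open>X - Y\<close>.\<close>

lemma side_disjoint_full_components:
  assumes X: "critical G X" and Y: "critical G Y" and XY: "\<not> X \<subseteq> Y" "\<not> Y \<subseteq> X"
    and C: "C \<in> full_components G X" "v \<in> C" "v \<notin> towards X Y"
  shows "v \<in> towards Y X"
proof -
  note C0 = towards_comps[OF Y critical_finite[OF X] XY(2)]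
  note D0 = towards_comps[OF X critical_finite[OF Y] XY(1)]
  have "C \<inter> Y = {}"
    using C C0 component_disjoint[OF full_components_comps[OF C(1)] C0(1)]
      comps_subset[OF full_components_comps[OF C(1)]] by blast
  then show ?thesis using full_component_absorb[OF C(1) _ D0(1)] D0(2) XY(1) C(2) by blast
qed

lemma lobe_cuts_nested_incomparable:
  assumes S: "disentangled S" and X: "critical G X" and C: "C \<in> full_components G X"
    and Y: "critical G Y" and D: "D \<in> full_components G Y"
    and XY: "\<not> X \<subseteq> Y" "\<not> Y \<subseteq> X"
  shows "\<exists>p\<in>orientations (cut X (lobe S X C)). \<exists>q\<in>orientations (cut Y (lobe S Y D)).
    sep_le p q \<or> sep_le q p"
proof -
  note C0 = towards_comps[OF Y critical_finite[OF X] XY(2)]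
  note D0 = towards_comps[OF X critical_finite[OF Y] XY(1)]
  obtain Q where Q: "Q \<subseteq> verts G - X" "cut X (lobe S X C) = cut X Q" "Q \<inter> towards X Y = {}"
    "Q \<inter> nonfull X = {} \<or> towards X Y \<in> full_components G X \<and> \<not> pole S X (towards X Y)"
    using lobe_cut_side[OF S X C C0(1)] by blast
  obtain R where R: "R \<subseteq> verts G - Y" "cut Y (lobe S Y D) = cut Y R" "R \<inter> towards Y X = {}"
    "R \<inter> nonfull Y = {} \<or> towards Y X \<in> full_components G Y \<and> \<not> pole S Y (towards Y X)"
    using lobe_cut_side[OF S Y D D0(1)] by blast
  \<comment> \<open>If both directions are full, \<open>X\<close> and \<open>Y\<close> are
    entangled, and then one of the directions is a pole.\<close>
  have "\<not> (towards X Y \<in> full_components G X \<and> \<not> pole S X (towards X Y) \<and>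
      towards Y X \<in> full_components G Y \<and> \<not> pole S Y (towards Y X))"
    using pole_entangled[OF S, of X Y] X Y XY by (auto simp: entangled_def)
  then have nonfull: "Q \<inter> nonfull X = {} \<or> R \<inter> nonfull Y = {}" using Q(4) R(4) by blast
  have "Q \<inter> R = {}"
  proof (rule ccontr)
    assume "\<not> ?thesis"
    then obtain v where v: "v \<in> Q" "v \<in> R" by blast
    \<comment> \<open>In a full component of \<open>X\<close>, the vertex \<open>v\<close> would lie
      in \<open>towards Y X\<close>, which \<open>R\<close> avoids.\<close>
    have "v \<in> nonfull X"
      using comps_full_or_nonfull[of v X] side_disjoint_full_components[OF X Y XY]
        v Q(1,3) R(3) by blast
    moreover have "v \<in> nonfull Y"
      using comps_full_or_nonfull[of v Y] side_disjoint_full_components[OF Y X XY(2,1)]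
        v R(1,3) Q(3) by blast
    ultimately show False using nonfull v by blast
  qed
  moreover have "Q \<inter> Y = {}" "R \<inter> X = {}" using Q(1,3) R(1,3) C0(2) D0(2) by auto
  ultimately show ?thesis
    using cut_nested[OF _ _ Q(1) R(1)] X Y Q(2) R(2) by (simp add: critical_def)
qed

text \<open>By uniqueness of the pole at most one lobe takes up the non-full components, so distinct
  lobes at \<open>X\<close> are disjoint.\<close>

lemma lobe_cuts_nested_star:
  assumes S: "disentangled S" and X: "critical G X" and C: "C \<in> full_components G X"
    and D: "D \<in> full_components G X"
  shows "\<exists>p\<in>orientations (cut X (lobe S X C)). \<exists>q\<in>orientations (cut X (lobe S X D)).
    sep_le p q \<or> sep_le q p"
proof (cases "C = D")
  case True
  let ?p = "(X \<union> lobe S X C, verts G - lobe S X C)"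
  have "?p \<in> orientations (cut X (lobe S X C))" "sep_le ?p ?p"
    by (auto simp: orientations_def cut_def sep_le_def)
  then show ?thesis using True by blast
next
  case False
  have "\<not> (pole S X C \<and> pole S X D)" using pole_unique[OF S] False by blast
  moreover have "C \<inter> D = {}"
    using component_disjoint[OF C[THEN full_components_comps] D[THEN full_components_comps]] False
    by blast
  ultimately have "lobe S X C \<inter> lobe S X D = {}"
    using nonfull_disjoint[OF C] nonfull_disjoint[OF D] by (auto simp: lobe_def)
  moreover have "X \<subseteq> verts G" using X by (simp add: critical_def)
  ultimately show ?thesis
    using lobe_subset[OF C, of S] lobe_subset[OF D, of S] by (intro cut_nested) auto
qed

lemma nested_lobe_cuts:
  assumes S: "disentangled S"
  shows "nested (lobe_cuts S)"
  unfolding nested_def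
proof (intro ballI)
  fix r s assume "r \<in> lobe_cuts S" "s \<in> lobe_cuts S"
  then obtain X C Y D where rs: "r = cut X (lobe S X C)" "s = cut Y (lobe S Y D)"
    and X: "critical G X" and C: "C \<in> full_components G X"
    and Y: "critical G Y" and D: "D \<in> full_components G Y"
    unfolding lobe_cuts_def by blast
  consider "X = Y" | "X \<subset> Y" | "Y \<subset> X" | "\<not> X \<subseteq> Y" "\<not> Y \<subseteq> X" by blast
  then show "\<exists>p\<in>orientations r. \<exists>q\<in>orientations s. sep_le p q \<or> sep_le q p"
  proof cases
    case 1
    then show ?thesis using lobe_cuts_nested_star[OF S X C] D rs by simp
  next
    case 2
    then show ?thesis using lobe_cuts_nested_subset[OF S X C Y D] rs by simp
  next
    case 3
    then show ?thesis using lobe_cuts_nested_subset[OF S Y D X C] rs by blast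
  next
    case 4
    then show ?thesis using lobe_cuts_nested_incomparable[OF S X C Y D] rs by simp
  qed
qed

section \<open>Tree set axioms and separators\<close>

text \<open>Criticality of \<open>X\<close> leaves another full component outside the lobe, so both
  sides are proper. This rules out degenerate and trivial orientations.\<close>

lemma lobe_cuts_orientation_proper:
  assumes "s \<in> lobe_cuts S" "p \<in> orientations s"
  shows "fst p \<union> snd p = verts G" "snd p \<noteq> verts G"
proof -
  obtain X C where s: "s = cut X (lobe S X C)" and X: "critical G X"
    and C: "C \<in> full_components G X"
    using assms(1) unfolding lobe_cuts_def by blast
  have Q: "lobe S X C \<subseteq> verts G - X" "lobe S X C \<noteq> {}"
    using lobe_subset[OF C, of S] component_nonempty[OF full_components_comps[OF C]]
    by (auto simp: lobe_def)
  have "infinite (full_components G X - {C})" using X by (simp add: critical_def)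
  then obtain C' where C': "C' \<in> full_components G X" "C \<noteq> C'"
    using infinite_imp_nonempty by blast
  note C'_comps = full_components_comps[OF C'(1)]
  have "C' \<noteq> {}" "C' \<subseteq> verts G - X" "lobe S X C \<inter> C' = {}"
    using component_nonempty[OF C'_comps] comps_subset[OF C'_comps]
      lobe_full_disjoint[OF C C', of S] by auto
  then have "X \<union> lobe S X C \<noteq> verts G" by blast
  moreover have "p = (X \<union> lobe S X C, verts G - lobe S X C) \<or>
      p = (verts G - lobe S X C, X \<union> lobe S X C)"
    using assms(2) by (auto simp: s cut_def orientations_def doubleton_eq_iff)
  moreover have "X \<subseteq> verts G" using X by (simp add: critical_def)
  ultimately show "fst p \<union> snd p = verts G" "snd p \<noteq> verts G" using Q by auto
qed

lemma tree_set_lobe_cuts: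
  assumes S: "disentangled S"
  shows "tree_set G (lobe_cuts S)"
  unfolding tree_set_def
proof (intro conjI ballI nested_lobe_cuts[OF S])
  fix s assume "s \<in> lobe_cuts S"
  then show "is_separation G s" using lobe_cut_separation by (auto simp: lobe_cuts_def)
next
  fix r p assume rp: "r \<in> lobe_cuts S" "p \<in> orientations r"
  note proper = lobe_cuts_orientation_proper
  show "\<not> degenerate p"
    using proper[OF rp] by (cases p) (auto simp: degenerate_def)
  show "\<not> trivial_in (lobe_cuts S) p"
  proof
    assume "trivial_in (lobe_cuts S) p"
    \<comment> \<open>Lying below both orientations of \<open>s\<close> puts both sides of
      \<open>s\<close> into \<open>snd p\<close>, and these cover the graph.\<close>
    then obtain s q where "s \<in> lobe_cuts S" "q \<in> orientations s"
      "snd q \<subseteq> snd p" "fst q \<subseteq> snd p"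
      unfolding trivial_in_def sep_less_def sep_le_def by auto
    then have "verts G \<subseteq> snd p" using proper(1) by blast
    then show False using proper[OF rp] by blast
  qed
qed

lemma separators_lobe_cuts:
  "{A \<inter> B | A B. {A, B} \<in> lobe_cuts S} = {X. critical G X}"
proof (intro set_eqI iffI)
  fix Z assume "Z \<in> {A \<inter> B | A B. {A, B} \<in> lobe_cuts S}"
  then obtain A B X C where Z: "Z = A \<inter> B" "{A, B} = cut X (lobe S X C)"
    and X: "critical G X" and C: "C \<in> full_components G X"
    unfolding lobe_cuts_def by auto
  have "A \<inter> B = (X \<union> lobe S X C) \<inter> (verts G - lobe S X C)"
    using Z(2) by (auto simp: cut_def doubleton_eq_iff)
  also have "\<dots> = X" using lobe_subset[OF C, of S] X by (auto simp: critical_def)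
  finally show "Z \<in> {X. critical G X}" using X Z(1) by simp
next
  fix X assume "X \<in> {X. critical G X}"
  then have X: "critical G X" by simp
  then have "full_components G X \<noteq> {}" using infinite_imp_nonempty by (auto simp: critical_def)
  then obtain C where C: "C \<in> full_components G X" by blast
  have "(X \<union> lobe S X C) \<inter> (verts G - lobe S X C) = X"
    using lobe_subset[OF C, of S] X by (auto simp: critical_def)
  moreover have "{X \<union> lobe S X C, verts G - lobe S X C} \<in> lobe_cuts S"
    using X C by (auto simp: lobe_cuts_def cut_def)
  ultimately show "X \<in> {A \<inter> B | A B. {A, B} \<in> lobe_cuts S}" by blast
qed

section \<open>Torsos\<close>

lemma sep_le_trans: "sep_le p q \<Longrightarrow> sep_le q r \<Longrightarrow> sep_le p r"
  by (auto simp: sep_le_def)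

lemma sep_le_antisym: "sep_le p q \<Longrightarrow> sep_le q p \<Longrightarrow> p = q"
  by (auto simp: sep_le_def prod_eq_iff)

lemma orientation_subset:
  "orientation_of T Or \<Longrightarrow> p \<in> Or \<Longrightarrow> \<exists>s\<in>T. p \<in> orientations s"
  by (auto simp: orientation_of_def)

lemma orientation_unique:
  assumes "orientation_of T Or" "s \<in> T" "p \<in> orientations s" "p \<in> Or"
    "q \<in> orientations s" "q \<in> Or"
  shows "p = q"
proof -
  have "\<exists>!p. p \<in> orientations s \<and> p \<in> Or" using assms(1,2) by (simp add: orientation_of_def)
  then show ?thesis using assms(3-6) by blast
qed

lemma consistentD:
  assumes "consistent T Or" "r \<in> T" "s \<in> T" "r \<noteq> s" "p \<in> orientations r" "q \<in> orientations s"
    "sep_less p q" "q \<in> Or"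
  shows "prod.swap p \<notin> Or"
  using assms unfolding consistent_def by blast

lemma swap_orientations: "p \<in> orientations s \<Longrightarrow> prod.swap p \<in> orientations s"
  by (auto simp: orientations_def insert_commute)

lemma orientations_cases:
  "a \<in> orientations s \<Longrightarrow> p \<in> orientations s \<Longrightarrow> a = p \<or> a = prod.swap p"
  by (auto simp: orientations_def doubleton_eq_iff)

text \<open>The conclusion says that \<open>p\<close> and \<open>q\<close> point towards each other.
  Of the comparisons allowed by nestedness, consistency excludes those in which they point away from
  each other.\<close>

lemma oriented_star:
  assumes T: "nested T" and Or: "orientation_of T Or" "consistent T Or"
    and p: "p \<in> Or" and q: "q \<in> Or"
    and incomp: "\<not> sep_le p q" "\<not> sep_le q p"
  shows "fst p \<subseteq> snd q"
proof -
  obtain r s where r: "r \<in> T" "p \<in> orientations r" and s: "s \<in> T" "q \<in> orientations s"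
    using orientation_subset[OF Or(1)] p q by meson
  have "p \<noteq> q" using incomp by (auto simp: sep_le_def)
  then have rs: "r \<noteq> s" using orientation_unique[OF Or(1) r p _ q] s(2) by blast
  have ne: "a \<noteq> b" if "a \<in> orientations r" "b \<in> orientations s" for a b
    using that rs by (auto simp: orientations_def)
  have "\<not> sep_le (prod.swap p) q"
    using consistentD[OF Or(2) r(1) s(1) rs swap_orientations[OF r(2)] s(2) _ q]
      ne[OF swap_orientations[OF r(2)] s(2)] p by (auto simp: sep_less_def)
  moreover obtain a b where "a \<in> orientations r" "b \<in> orientations s" "sep_le a b \<or> sep_le b a"
    using T r(1) s(1) unfolding nested_def by blast
  ultimately have "sep_le p (prod.swap q) \<or> sep_le q (prod.swap p)"
    using orientations_cases[OF _ r(2), of a] orientations_cases[OF _ s(2), of b] incomp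
    by (auto simp: sep_le_def)
  then show ?thesis by (auto simp: sep_le_def)
qed

lemma rtranclp_finite_support:
  assumes "r\<^sup>*\<^sup>* x y"
  shows "\<exists>W. finite W \<and> x \<in> W \<and> (\<lambda>u v. r u v \<and> u \<in> W \<and> v \<in> W)\<^sup>*\<^sup>* x y"
  using assms
proof induction
  case base
  show ?case by (intro exI[of _ "{x}"]) simp
next
  case (step u v)
  then obtain W where W: "finite W" "x \<in> W" "(\<lambda>u v. r u v \<and> u \<in> W \<and> v \<in> W)\<^sup>*\<^sup>* x u" by blast
  let ?r = "\<lambda>a b. r a b \<and> a \<in> insert u (insert v W) \<and> b \<in> insert u (insert v W)"
  have "?r\<^sup>*\<^sup>* x u" using W(3) by (rule rtranclp_mono[THEN predicate2D, rotated]) auto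
  then have "?r\<^sup>*\<^sup>* x v" using step(2) by (simp add: rtranclp.rtrancl_into_rtrancl)
  then show ?case using W by (intro exI[of _ "insert u (insert v W)"]) simp
qed

text \<open>\<open>Or\<close> may lack maximal elements. Hence one separation is chosen for each of
  the finitely many vertices of \<open>W\<close> outside the part, and only the maximal ones among
  these are kept.\<close>

lemma oriented_star_cover:
  assumes T: "nested T" and Or: "orientation_of T Or" "consistent T Or"
    and W: "finite W" "W \<subseteq> verts G"
  obtains F where "F \<subseteq> Or" "\<And>w. w \<in> W \<Longrightarrow> w \<notin> part G Or \<Longrightarrow> \<exists>p\<in>F. w \<notin> snd p"
    "\<And>p q. p \<in> F \<Longrightarrow> q \<in> F \<Longrightarrow> p \<noteq> q \<Longrightarrow> fst p \<subseteq> snd q"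
proof -
  have "\<forall>w. \<exists>p. w \<in> W - part G Or \<longrightarrow> p \<in> Or \<and> w \<notin> snd p"
    using W(2) unfolding part_def by fastforce
  then obtain g where g: "\<And>w. w \<in> W - part G Or \<Longrightarrow> g w \<in> Or \<and> w \<notin> snd (g w)" by metis
  define F0 where "F0 = g ` (W - part G Or)"
  \<comment> \<open>A maximal element above \<open>g w\<close> has a smaller second side and so
    still excludes \<open>w\<close>; distinct maximal elements are incomparable.\<close>
  define F where "F = {p \<in> F0. \<forall>q\<in>F0. sep_le p q \<longrightarrow> q = p}"
  have F0: "finite F0" "F0 \<subseteq> Or" using W(1) g by (auto simp: F0_def)
  have max: "\<exists>m\<in>F. sep_le p m" if p: "p \<in> F0" for p
  proof -
    let ?A = "{q \<in> F0. sep_le p q}"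
    have "\<exists>m\<in>?A. \<forall>q\<in>?A. q \<noteq> m \<longrightarrow> \<not> sep_less m q"
    proof (rule Finite_Set.bex_max_element)
      show "finite ?A" using F0 by simp
      have "p \<in> ?A" using p by (simp add: sep_le_def)
      then show "?A \<noteq> {}" by blast
      show "asymp_on ?A sep_less" "transp_on ?A sep_less"
        using sep_le_trans sep_le_antisym
        by (blast intro!: asymp_onI transp_onI sep_less_def[THEN iffD2] dest: sep_less_def[THEN iffD1])+
    qed
    then obtain m where m: "m \<in> F0" "sep_le p m" "\<And>q. q \<in> ?A \<Longrightarrow> q \<noteq> m \<Longrightarrow> \<not> sep_less m q"
      by blast
    have "q = m" if q: "q \<in> F0" "sep_le m q" for q
    proof -
      have "sep_le p q" using m(2) q(2) by (auto simp: sep_le_def)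
      then show ?thesis using m(3)[of q] q by (auto simp: sep_less_def)
    qed
    then show ?thesis using m(1,2) unfolding F_def by blast
  qed
  show thesis
  proof
    show "F \<subseteq> Or" using F0(2) by (auto simp: F_def)
  next
    fix w assume w: "w \<in> W" "w \<notin> part G Or"
    then obtain m where "m \<in> F" "sep_le (g w) m" using max[of "g w"] by (auto simp: F0_def)
    then show "\<exists>p\<in>F. w \<notin> snd p" using g[of w] w by (auto simp: sep_le_def)
  next
    fix p q assume pq: "p \<in> F" "q \<in> F" "p \<noteq> q"
    then have "\<not> sep_le p q" "\<not> sep_le q p" "p \<in> Or" "q \<in> Or" using F0(2) by (auto simp: F_def)
    then show "fst p \<subseteq> snd q" using oriented_star[OF T Or] by blast
  qed
qed

lemma adj_torso:
  "adj (torso G Or) x y \<longleftrightarrow> x \<in> part G Or \<and> y \<in> part G Or \<and>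
     (adj G x y \<or> x \<noteq> y \<and> (\<exists>p\<in>Or. x \<in> fst p \<inter> snd p \<and> y \<in> fst p \<inter> snd p))"
proof -
  have "adj (torso G Or) x y \<longleftrightarrow> (adj G x y \<and> x \<in> part G Or \<and> y \<in> part G Or) \<or>
    (\<exists>u v. {x, y} = {u, v} \<and> u \<in> part G Or \<and> v \<in> part G Or \<and> u \<noteq> v \<and>
      (\<exists>p\<in>Or. u \<in> fst p \<inter> snd p \<and> v \<in> fst p \<inter> snd p))"
    by (simp add: adj_def torso_def induced_subgraph_def case_prod_beta)
  then show ?thesis by (auto simp: doubleton_eq_iff)
qed

lemma part_subset: "part G Or \<subseteq> verts G"
  by (auto simp: part_def)

lemma part_snd: "x \<in> part G Or \<Longrightarrow> p \<in> Or \<Longrightarrow> x \<in> snd p"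
  by (auto simp: part_def)

lemma verts_torso [simp]: "verts (torso G Or) = part G Or"
  by (simp add: torso_def)

lemma separation_orientation:
  assumes "is_separation G s" "p \<in> orientations s" "adj G u v"
  shows "u \<notin> snd p \<Longrightarrow> v \<in> fst p"
    and "v \<notin> snd p \<Longrightarrow> u \<in> fst p"
proof -
  obtain A B where "s = {A, B}" and AB: "A \<union> B = verts G" "\<not> (\<exists>x\<in>A - B. \<exists>y\<in>B - A. adj G x y)"
    using assms(1) unfolding is_separation_def by blast
  then have p: "p = (A, B) \<or> p = (B, A)"
    using assms(2) by (auto simp: orientations_def doubleton_eq_iff)
  have uv: "u \<in> A \<union> B" "v \<in> A \<union> B" "adj G v u"
    using adj_verts[OF assms(3)] adj_sym[OF assms(3)] AB(1) by auto
  show "u \<notin> snd p \<Longrightarrow> v \<in> fst p" "v \<notin> snd p \<Longrightarrow> u \<in> fst p"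
    using p uv AB(2) assms(3) by (metis DiffI UnE fst_conv snd_conv)+
qed

section \<open>Shortcutting walks in the torso\<close>

text \<open>Each excursion of the walk outside the part leaves and returns through the separator of
  a single member of \<open>F\<close>, whose vertices in the part are pairwise adjacent in the
  torso.\<close>

lemma linked_torso:
  assumes T: "tree_set G T" and Or: "orientation_of T Or" "consistent T Or"
    and xy: "x \<in> part G Or" "y \<in> part G Or" and link: "linked (delete_verts G X) x y"
  shows "linked (delete_verts (torso G Or) X) x y"
proof -
  let ?H = "delete_verts (torso G Or) X"
  have adj_H: "adj ?H u v"
    if "adj (torso G Or) u v" "u \<in> part G Or" "v \<in> part G Or" "u \<notin> X" "v \<notin> X" for u v
    using that by (simp add: adj_def delete_verts_def induced_subgraph_def)
  have x: "x \<notin> X" "y \<notin> X" using link by (auto simp: linked_def)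
  have "(adj (delete_verts G X))\<^sup>*\<^sup>* x y" using link by (simp add: linked_def)
  from rtranclp_finite_support[OF this] obtain W where W: "finite W" "x \<in> W"
    "(\<lambda>u v. adj (delete_verts G X) u v \<and> u \<in> W \<and> v \<in> W)\<^sup>*\<^sup>* x y"
    by blast
  have nested: "nested T" using T by (simp add: tree_set_def)
  obtain F where F: "F \<subseteq> Or"
    "\<And>w. w \<in> W \<inter> verts G \<Longrightarrow> w \<notin> part G Or \<Longrightarrow> \<exists>p\<in>F. w \<notin> snd p"
    "\<And>p q. p \<in> F \<Longrightarrow> q \<in> F \<Longrightarrow> p \<noteq> q \<Longrightarrow> fst p \<subseteq> snd q"
    using oriented_star_cover[OF nested Or, of "W \<inter> verts G"] W(1) by blast
  have sep: "u \<notin> snd p \<Longrightarrow> v \<in> fst p" "v \<notin> snd p \<Longrightarrow> u \<in> fst p"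
    if p: "p \<in> F" and uv: "adj G u v" for p u v
  proof -
    obtain s where "s \<in> T" "p \<in> orientations s"
      using orientation_subset[OF Or(1)] p F(1) by blast
    then show "u \<notin> snd p \<Longrightarrow> v \<in> fst p" "v \<notin> snd p \<Longrightarrow> u \<in> fst p"
      using separation_orientation[of s p u v] uv T by (auto simp: tree_set_def)
  qed
  define reach where "reach u \<longleftrightarrow> u \<in> part G Or \<and> u \<notin> X \<and> (adj ?H)\<^sup>*\<^sup>* x u" for u
  have reach_step: "reach v" if "reach u" "v \<in> part G Or" "v \<notin> X" "u = v \<or> adj (torso G Or) u v"
    for u v
    using that unfolding reach_def by (auto intro: adj_H rtranclp.rtrancl_into_rtrancl)
  \<comment> \<open>While the walk is outside the part, it stays behind the separator through which it left.\<close>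
  have "reach y \<or> (\<exists>p\<in>F. y \<notin> snd p \<and> (\<exists>u. reach u \<and> u \<in> fst p))"
    using W(3)
  proof induction
    case base
    then show ?case using xy(1) x(1) by (simp add: reach_def)
  next
    case (step v w)
    then have vw: "adj G v w" "w \<notin> X" "w \<in> W \<inter> verts G"
      using adj_verts[of v w] by (auto simp: adj_delete_verts)
    show ?case
    proof (cases "reach v")
      case True
      show ?thesis
      proof (cases "w \<in> part G Or")
        case True
        then have "adj (torso G Or) v w" using \<open>reach v\<close> vw by (simp add: adj_torso reach_def)
        then show ?thesis using reach_step[OF \<open>reach v\<close> True vw(2)] by blast
      next
        case False
        then obtain p where "p \<in> F" "w \<notin> snd p" using F(2) vw(3) by blast
        then show ?thesis using sep(2)[OF _ vw(1)] \<open>reach v\<close> by blast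
      qed
    next
      case False
      then obtain p u where p: "p \<in> F" "v \<notin> snd p" and u: "reach u" "u \<in> fst p"
        using step.IH by blast
      have w: "w \<in> fst p" using sep(1)[OF p(1) vw(1) p(2)] .
      show ?thesis
      proof (cases "w \<in> part G Or")
        case True
        have "p \<in> Or" using p(1) F(1) by blast
        moreover have "u \<in> part G Or" using u(1) by (simp add: reach_def)
        \<comment> \<open>Both \<open>u\<close> and \<open>w\<close> lie in \<open>fst p\<close>,
          and in \<open>snd p\<close> as members of the part, hence in the separator of
          \<open>p\<close>.\<close>
        ultimately have "u = w \<or> adj (torso G Or) u w"
          using True u(2) w part_snd[of _ Or p] by (auto simp: adj_torso)
        then show ?thesis using reach_step[OF u(1) True vw(2)] by blast
      next
        case False
        then obtain q where q: "q \<in> F" "w \<notin> snd q" using F(2) vw(3) by blast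
        \<comment> \<open>Otherwise \<open>w\<close>, which is in \<open>fst p\<close>, would lie in
          \<open>snd q\<close> by the star property.\<close>
        then have "q = p" using F(3)[OF p(1) q(1)] w by blast
        then show ?thesis using q u by blast
      qed
    qed
  qed
  then have "reach y" using part_snd[OF xy(2)] F(1) by blast
  then show ?thesis using xy x by (auto simp: reach_def linked_def)
qed

section \<open>Toughness of the torsos\<close>

text \<open>As \<open>C\<close> is not a pole, it is its own lobe, so \<open>Or\<close> orients
  \<open>cut X C\<close>. The part lies in the side pointed to, and meeting \<open>C\<close>
  determines which side that is.\<close>

lemma lobe_cut_oriented_towards:
  assumes Or: "orientation_of (lobe_cuts S) Or"
    and X: "critical G X" and C: "C \<in> full_components G X" "\<not> pole S X C"
    and meet: "C \<inter> part G Or \<noteq> {}"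
  shows "part G Or \<subseteq> X \<union> C"
proof -
  have "cut X C \<in> lobe_cuts S" using X C unfolding lobe_cuts_def lobe_def by force
  then obtain p where p: "p \<in> orientations (cut X C)" "p \<in> Or"
    using Or unfolding orientation_of_def by blast
  have "p = (X \<union> C, verts G - C) \<or> p = (verts G - C, X \<union> C)"
    using p(1) by (auto simp: orientations_def cut_def doubleton_eq_iff)
  moreover have "part G Or \<subseteq> snd p" using part_snd p(2) by blast
  ultimately show ?thesis using meet by auto
qed

text \<open>Neighbourhoods of components are subsets of the finite set \<open>X\<close>, so
  infinitely many members of \<open>\<C>\<close> share one, by pigeonhole. These are full components
  of the shared neighbourhood by \<open>comps_change\<close>.\<close>

lemma infinite_comps_full_components:
  assumes X: "finite X" "X \<subseteq> verts G" and \<C>: "infinite \<C>" "\<C> \<subseteq> comps G X"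
  obtains Y where "critical G Y" "infinite (\<C> \<inter> full_components G Y)"
proof -
  have N: "neighbourhood G ` \<C> \<subseteq> Pow X" using \<C>(2) neighbourhood_comps by blast
  then have "finite (neighbourhood G ` \<C>)" using X(1) finite_subset by blast
  then obtain C where C: "C \<in> \<C>" "infinite {D \<in> \<C>. neighbourhood G D = neighbourhood G C}"
    using pigeonhole_infinite[OF \<C>(1)] by blast
  let ?Y = "neighbourhood G C"
  have Y: "?Y \<subseteq> X" using N C(1) by blast
  have "{D \<in> \<C>. neighbourhood G D = ?Y} \<subseteq> \<C> \<inter> full_components G ?Y"
  proof
    fix D assume D: "D \<in> {D \<in> \<C>. neighbourhood G D = ?Y}"
    then have DX: "D \<in> comps G X" using \<C>(2) by blast
    then have "D \<inter> ?Y = {}" using comps_subset[OF DX] Y by blast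
    then show "D \<in> \<C> \<inter> full_components G ?Y"
      using comps_change[OF DX] D by (auto simp: full_components_def)
  qed
  then have inf: "infinite (\<C> \<inter> full_components G ?Y)" using C(2) finite_subset by blast
  moreover have "critical G ?Y"
    using inf Y X finite_subset by (auto simp: critical_def)
  ultimately show thesis using that by blast
qed

lemma tough_torso_lobe_cuts:
  assumes S: "disentangled S"
    and Or: "orientation_of (lobe_cuts S) Or" "consistent (lobe_cuts S) Or"
  shows "tough (torso G Or)"
  unfolding tough_def
proof (intro allI impI, rule ccontr)
  fix X assume X: "X \<subseteq> verts (torso G Or) \<and> finite X"
    and inf: "infinite (comps (torso G Or) X)"
  let ?\<C> = "{C \<in> comps G X. C \<inter> part G Or \<noteq> {}}"
  have Xv: "X \<subseteq> verts G" using X part_subset by auto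
  have "\<forall>K\<in>comps (torso G Or) X. \<exists>C. C \<in> ?\<C> \<and> C \<inter> K \<noteq> {}"
  proof
    fix K assume K: "K \<in> comps (torso G Or) X"
    obtain v where v: "v \<in> K" using component_nonempty[OF K] by blast
    then have v': "v \<in> part G Or" "v \<notin> X" using comps_subset[OF K] by auto
    then obtain C where "C \<in> comps G X" "v \<in> C" using comps_cover part_subset by (metis subsetD)
    then show "\<exists>C. C \<in> ?\<C> \<and> C \<inter> K \<noteq> {}" using v v' by blast
  qed
  from bchoice[OF this] obtain f
    where f: "\<And>K. K \<in> comps (torso G Or) X \<Longrightarrow> f K \<in> ?\<C> \<and> f K \<inter> K \<noteq> {}"
    by blast
  \<comment> \<open>Two components of the torso minus \<open>X\<close> meeting the same component of
    \<open>G - X\<close> would be linked by \<open>linked_torso\<close>.\<close>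
  have "inj_on f (comps (torso G Or) X)"
  proof (rule inj_onI)
    fix K L assume K: "K \<in> comps (torso G Or) X" and L: "L \<in> comps (torso G Or) X"
      and fKL: "f K = f L"
    obtain u v where uv: "u \<in> f K" "u \<in> K" "v \<in> f K" "v \<in> L" using f[OF K] f[OF L] fKL by auto
    have "f K \<in> comps G X" using f[OF K] by blast
    then have "linked (delete_verts G X) u v" using component_eq[OF _ uv(1)] uv(3) by blast
    moreover have "u \<in> part G Or" "v \<in> part G Or" using comps_subset[OF K] comps_subset[OF L] uv by auto
    ultimately have "linked (delete_verts (torso G Or) X) u v"
      using linked_torso[OF tree_set_lobe_cuts[OF S] Or] by blast
    then have "v \<in> K" using component_eq[OF K uv(2)] by blast
    then show "K = L" using component_disjoint[OF K L] uv(4) by blast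
  qed
  moreover have "f ` comps (torso G Or) X \<subseteq> ?\<C>" using f by blast
  ultimately have "infinite ?\<C>" using inf inj_on_finite by blast
  then obtain Y where Y: "critical G Y" "infinite (?\<C> \<inter> full_components G Y)"
    using infinite_comps_full_components[of X ?\<C>] X Xv by blast
  \<comment> \<open>A pole is discarded because its lobe may be larger than the component; there is
    at most one, so infinitely many components remain.\<close>
  let ?\<D> = "{C \<in> full_components G Y. C \<inter> part G Or \<noteq> {} \<and> \<not> pole S Y C}"
  have sub: "?\<C> \<inter> full_components G Y \<subseteq> ?\<D> \<union> {C. pole S Y C}" by blast
  have "finite {C. pole S Y C}"
  proof (cases "\<exists>C. pole S Y C")
    case True
    then obtain C where "pole S Y C" ..
    then have "{C. pole S Y C} \<subseteq> {C}" using pole_unique[OF S] by blast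
    then show ?thesis using finite_subset by blast
  qed simp
  then have "infinite ?\<D>" using Y(2) finite_subset[OF sub] by blast
  then obtain C where C': "C \<in> ?\<D>" using infinite_imp_nonempty by blast
  have "infinite (?\<D> - {C})" using \<open>infinite ?\<D>\<close> by simp
  then obtain D where D': "D \<in> ?\<D>" "C \<noteq> D" using infinite_imp_nonempty by blast
  \<comment> \<open>Two disjoint components \<open>C\<close> and \<open>D\<close> together confine
    the part to \<open>Y\<close>, although it meets \<open>C\<close>.\<close>
  have "part G Or \<subseteq> Y \<union> C" "part G Or \<subseteq> Y \<union> D"
    using lobe_cut_oriented_towards[OF Or(1) Y(1)] C' D' by auto
  moreover have C: "C \<in> comps G Y" and D: "D \<in> comps G Y"
    using C' D' full_components_comps by auto
  moreover have "C \<inter> D = {}" using component_disjoint[OF C D] D'(2) by blast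
  moreover have "C \<inter> Y = {}" using comps_subset[OF C] by blast
  moreover have "C \<inter> part G Or \<noteq> {}" using C' by blast
  ultimately show False by blast
qed

end

theorem theorem2:
  fixes G :: "'a graph"
  assumes "simple_graph G"
    and "connected_graph G"
  shows "\<exists>T. tree_set G T \<and>
    {A \<inter> B | A B. {A, B} \<in> T} = {X. critical G X} \<and>
    (\<forall>Or. orientation_of T Or \<and> consistent T Or \<longrightarrow> tough (torso G Or))"
proof -
  obtain S where S: "disentangled G S"
    using ex_disentangled[OF assms(1)] by blast
  show ?thesis
    using tree_set_lobe_cuts[OF assms(1) S] separators_lobe_cuts[OF assms(1)]
      tough_torso_lobe_cuts[OF assms(1) S]
    by (intro exI[of _ "lobe_cuts G S"]) blast
qed

end
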